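(* For all $n\geq 1$, $$\mathrm{pspa}'(n)-\mathrm{pspa}(n)\equiv \mathrm{spa}'(n)-\mathrm{spa}(n) \pmod 3.$$
   Context: The semi-Padovan sequence is defined by $\mathrm{spa}(0)=1$, $\mathrm{spa}(1)=0$, and for $n\ge1$: $\mathrm{spa}(2n)=\mathrm{spa}(n)$, $\mathrm{spa}(2n+1)=\mathrm{spa}(2n-1)+\mathrm{spa}(2n-2)$. The modified semi-Padovan sequence $\mathrm{spa}'(n)$ satisfies the same recurrences (for $n\ge1$) with $\mathrm{spa}'(0)=0$, $\mathrm{spa}'(1)=1$. For $n\ge1$, $\mathrm{pspa}(n)$ (respectively $\mathrm{pspa}'(n)$) denotes the total number of parts (counted with multiplicity) in all the partitions in $\mathcal{SP}a(n)$ (respectively $\mathcal{SP}a'(n)$), defined as follows. A partition of $n$ is a weakly decreasing sequence (equivalently, a finite multiset) of positive integers with sum $n$. $\lambda\sqcup\mu$ is the partition whose multiset of parts is the multiset union (multiplicities added) of the parts of $\lambda$ and $\mu$; $2\lambda$ is obtained by doubling every part; if $\lambda$ has an odd part, $\lambda^{o+2}$ is obtained by adding $2$ to (one occurrence of) the largest odd part of $\lambda$. These operations are applied elementwise to sets of partitions (giving $\emptyset$ for the empty set). Semi-Padovan partitions: $\mathcal{SP}a(0)=\{(\,)\}$ (the set containing the empty partition), $\mathcal{SP}a(1)=\emptyset$, $\mathcal{SP}a(3)=\{(3)\}$, $\mathcal{SP}a(2n)=2\,\mathcal{SP}a(n)$ for $n\ge1$, and $\mathcal{SP}a(2n+1)=\mathcal{SP}a(2n-1)^{o+2}\cup\big(\mathcal{SP}a(2n-2)\sqcup(1,1,1)\big)$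 for $n\ge2$. Modified semi-Padovan partitions: $\mathcal{SP}a'(0)=\emptyset$, $\mathcal{SP}a'(1)=\{(1)\}$, and for $n\ge1$: $\mathcal{SP}a'(2n)=2\,\mathcal{SP}a'(n)$ and $\mathcal{SP}a'(2n+1)=\mathcal{SP}a'(2n-1)^{o+2}\cup\big(\mathcal{SP}a'(2n-2)\sqcup(1,1,1)\big)$. *)

theory Defs
  imports "HOL-Library.Multiset" "HOL-Number_Theory.Cong"
begin

function spa :: "nat \<Rightarrow> nat" where
  "spa 0 = 1"
| "spa 1 = 0"
| "n \<ge> 1 \<Longrightarrow> spa (2 * n) = spa n"
| "n \<ge> 1 \<Longrightarrow> spa (2 * n + 1) = spa (2 * n - 1) + spa (2 * n - 2)"
proof -
  fix P :: bool and x :: nat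
  assume "x = 0 \<Longrightarrow> P" "x = 1 \<Longrightarrow> P"
    "\<And>n. n \<ge> 1 \<Longrightarrow> x = 2 * n \<Longrightarrow> P" "\<And>n. n \<ge> 1 \<Longrightarrow> x = 2 * n + 1 \<Longrightarrow> P"
  moreover have "x = 0 \<or> x = 1 \<or> (\<exists>n\<ge>1. x = 2 * n) \<or> (\<exists>n\<ge>1. x = 2 * n + 1)"
    by presburger
  ultimately show P by blast
qed (auto dest: arg_cong[where f = even])
termination by (relation "measure id") auto

function spa' :: "nat \<Rightarrow> nat" where
  "spa' 0 = 0"
| "spa' 1 = 1"
| "n \<ge> 1 \<Longrightarrow> spa' (2 * n) = spa' n"
| "n \<ge> 1 \<Longrightarrow> spa' (2 * n + 1) = spa' (2 * n - 1) + spa' (2 * n - 2)"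
proof -
  fix P :: bool and x :: nat
  assume "x = 0 \<Longrightarrow> P" "x = 1 \<Longrightarrow> P"
    "\<And>n. n \<ge> 1 \<Longrightarrow> x = 2 * n \<Longrightarrow> P" "\<And>n. n \<ge> 1 \<Longrightarrow> x = 2 * n + 1 \<Longrightarrow> P"
  moreover have "x = 0 \<or> x = 1 \<or> (\<exists>n\<ge>1. x = 2 * n) \<or> (\<exists>n\<ge>1. x = 2 * n + 1)"
    by presburger
  ultimately show P by blast
qed (auto dest: arg_cong[where f = even])
termination by (relation "measure id") auto

text \<open>A partition is the multiset of its parts, so \<open>\<lambda> \<squnion> \<mu>\<close> is multiset addition.\<close>

definition double_parts :: "nat multiset \<Rightarrow> nat multiset" where
  "double_parts p = image_mset (\<lambda>k. 2 * k) p"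

text \<open>The operation \<open>\<lambda>\<^sup>o\<^sup>+\<^sup>2\<close>; meaningful only if \<open>p\<close> has an odd part. Every partition in the
  sets below to which it is applied has one (lemmas \<open>SPa_odd_part\<close> and \<open>SPa'_odd_part\<close>).\<close>

definition odd_plus2 :: "nat multiset \<Rightarrow> nat multiset" where
  "odd_plus2 p = (let m = Max {k. k \<in># p \<and> odd k} in add_mset (m + 2) (p - {#m#}))"

function SPa :: "nat \<Rightarrow> nat multiset set" where
  "SPa 0 = {{#}}"
| "SPa 1 = {}"
| "SPa 3 = {{#3#}}"
| "n \<ge> 1 \<Longrightarrow> SPa (2 * n) = double_parts ` SPa n"
| "n \<ge> 2 \<Longrightarrow> SPa (2 * n + 1) =
     odd_plus2 ` SPa (2 * n - 1) \<union> (\<lambda>p. p + {#1, 1, 1#}) ` SPa (2 * n - 2)"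
proof -
  fix P :: bool and x :: nat
  assume "x = 0 \<Longrightarrow> P" "x = 1 \<Longrightarrow> P" "x = 3 \<Longrightarrow> P"
    "\<And>n. n \<ge> 1 \<Longrightarrow> x = 2 * n \<Longrightarrow> P" "\<And>n. n \<ge> 2 \<Longrightarrow> x = 2 * n + 1 \<Longrightarrow> P"
  moreover have "x = 0 \<or> x = 1 \<or> x = 3 \<or> (\<exists>n\<ge>1. x = 2 * n) \<or> (\<exists>n\<ge>2. x = 2 * n + 1)"
    by presburger
  ultimately show P by blast
qed (auto dest: arg_cong[where f = even])
termination by (relation "measure id") auto

function SPa' :: "nat \<Rightarrow> nat multiset set" where
  "SPa' 0 = {}"
| "SPa' 1 = {{#1#}}"
| "n \<ge> 1 \<Longrightarrow> SPa' (2 * n) = double_parts ` SPa' n"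
| "n \<ge> 1 \<Longrightarrow> SPa' (2 * n + 1) =
     odd_plus2 ` SPa' (2 * n - 1) \<union> (\<lambda>p. p + {#1, 1, 1#}) ` SPa' (2 * n - 2)"
proof -
  fix P :: bool and x :: nat
  assume "x = 0 \<Longrightarrow> P" "x = 1 \<Longrightarrow> P"
    "\<And>n. n \<ge> 1 \<Longrightarrow> x = 2 * n \<Longrightarrow> P" "\<And>n. n \<ge> 1 \<Longrightarrow> x = 2 * n + 1 \<Longrightarrow> P"
  moreover have "x = 0 \<or> x = 1 \<or> (\<exists>n\<ge>1. x = 2 * n) \<or> (\<exists>n\<ge>1. x = 2 * n + 1)"
    by presburger
  ultimately show P by blast
qed (auto dest: arg_cong[where f = even])
termination by (relation "measure id") auto

lemma odd_part_if_odd_sum: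
  fixes p :: "nat multiset"
  assumes "odd (sum_mset p)"
  shows "\<exists>k. k \<in># p \<and> odd k"
  using assms by (induction p) auto

lemma sum_mset_double_parts: "sum_mset (double_parts p) = 2 * sum_mset p"
  by (induction p) (auto simp: double_parts_def)

lemma sum_mset_odd_plus2:
  assumes "odd (sum_mset p)"
  shows "sum_mset (odd_plus2 p) = sum_mset p + 2"
proof -
  let ?m = "Max {k. k \<in># p \<and> odd k}"
  have "?m \<in> {k. k \<in># p \<and> odd k}"
    by (rule Max_in) (use odd_part_if_odd_sum[OF assms] in auto)
  then obtain q where "p = add_mset ?m q"
    by (auto dest: multi_member_split)
  then have "sum_mset p = ?m + sum_mset (p - {#?m#})"
    by (metis add_mset_remove_trivial sum_mset.add_mset)
  then show ?thesis
    by (simp add: odd_plus2_def Let_def)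
qed

lemma sum_mset_SPa: "p \<in> SPa n \<Longrightarrow> sum_mset p = n"
  by (induction n arbitrary: p rule: SPa.induct)
    (auto simp: sum_mset_double_parts sum_mset_odd_plus2 simp del: One_nat_def)

lemma sum_mset_SPa': "p \<in> SPa' n \<Longrightarrow> sum_mset p = n"
  by (induction n arbitrary: p rule: SPa'.induct)
    (auto simp: sum_mset_double_parts sum_mset_odd_plus2 simp del: One_nat_def)

lemma SPa_odd_part: "odd n \<Longrightarrow> p \<in> SPa n \<Longrightarrow> \<exists>k. k \<in># p \<and> odd k"
  using odd_part_if_odd_sum sum_mset_SPa by metis

lemma SPa'_odd_part: "odd n \<Longrightarrow> p \<in> SPa' n \<Longrightarrow> \<exists>k. k \<in># p \<and> odd k"
  using odd_part_if_odd_sum sum_mset_SPa' by metis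

lemma finite_SPa: "finite (SPa n)"
  by (induction n rule: SPa.induct) (auto simp del: One_nat_def)

lemma finite_SPa': "finite (SPa' n)"
  by (induction n rule: SPa'.induct) (auto simp del: One_nat_def)

definition pspa :: "nat \<Rightarrow> nat" where
  "pspa n = (\<Sum>p\<in>SPa n. size p)"

definition pspa' :: "nat \<Rightarrow> nat" where
  "pspa' n = (\<Sum>p\<in>SPa' n. size p)"

end

theory Submission imports Defs begin

text \<open>Both halves of the congruence hold separately: for \<open>n \<ge> 1\<close> the total number of parts is
  congruent modulo 3 to the term of the sequence with the same name.

  The reason is that the number of parts obeys, modulo 3, the recurrence of the sequence. Doubling
  parts and \<open>\<lambda>\<^sup>o\<^sup>+\<^sup>2\<close> leave the number of parts of a partition alone, while adjoining \<open>(1,1,1)\<close>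
  raises it by 3. Hence pspa and pspa' satisfy the recurrences of spa and spa' modulo 3 (for
  pspa from index 5 on, where the recursion of the partitions takes this form), provided that the
  recursive construction never produces the same partition twice. This uniqueness is the content of
  \<open>inj_on_odd_plus2\<close> (the enlarged part can be recognised as the largest odd
  part of the result) and of \<open>sum_size_odd_step_cong\<close> (a partition coming from \<open>\<lambda>\<^sup>o\<^sup>+\<^sup>2\<close> has an odd
  part of size at least 3, whereas one with \<open>(1,1,1)\<close> adjoined to even parts has not).

  The starting values agree as well. For the primed family they agree at 0 and 1. For the other
  family they disagree at 0, because the empty partition is one partition without parts; the
  values at 1 and 3 agree, and every later step of the recurrence refers only to positive indices.\<close>

section \<open>Enlarging the largest odd part\<close>

lemma odd_plus2_add_mset_largest_odd:
  assumes "odd m" and "\<And>k. k \<in># q \<Longrightarrow> odd k \<Longrightarrow> k \<le> m"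
  shows "odd_plus2 (add_mset m q) = add_mset (m + 2) q"
proof -
  have "Max {k. k \<in># add_mset m q \<and> odd k} = m"
    by (rule Max_eqI) (use assms in auto)
  then show ?thesis
    by (simp add: odd_plus2_def Let_def)
qed

text \<open>Splitting off the largest odd part brings a partition into the form on which
  \<open>odd_plus2\<close> can be computed without the maximum.\<close>

lemma odd_plus2_split:
  assumes "\<exists>k. k \<in># p \<and> odd k"
  obtains m q where "p = add_mset m q" "odd m" "\<And>k. k \<in># q \<Longrightarrow> odd k \<Longrightarrow> k \<le> m"
    "odd_plus2 p = add_mset (m + 2) q"
proof -
  let ?O = "{k. k \<in># p \<and> odd k}"
  have fin: "finite ?O"
    by simp
  have m: "Max ?O \<in> ?O"
    by (rule Max_in[OF fin]) (use assms in auto)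
  then obtain q where q: "p = add_mset (Max ?O) q"
    by (auto dest: multi_member_split)
  have "k \<in># p" if "k \<in># q" for k
    using that by (subst q) simp
  then have le: "k \<le> Max ?O" if "k \<in># q" "odd k" for k
    using that by (intro Max_ge[OF fin]) simp
  have "odd_plus2 p = add_mset (Max ?O + 2) q"
    by (subst q, rule odd_plus2_add_mset_largest_odd) (use m le in simp_all)
  with q m le show thesis
    by (intro that[of "Max ?O" q]) simp_all
qed

lemma size_odd_plus2: "\<exists>k. k \<in># p \<and> odd k \<Longrightarrow> size (odd_plus2 p) = size p"
  by (erule odd_plus2_split) simp

text \<open>If \<open>m + 2\<close> and \<open>m' + 2\<close> were two different enlarged parts of the same partition, each would
  be an odd part untouched in the other preimage, so \<open>m + 2 \<le> m'\<close> and \<open>m' + 2 \<le> m\<close>.\<close>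

lemma inj_on_odd_plus2: "inj_on odd_plus2 {p. \<exists>k. k \<in># p \<and> odd k}"
proof (rule inj_onI)
  fix p p' :: "nat multiset"
  assume "p \<in> {p. \<exists>k. k \<in># p \<and> odd k}" "p' \<in> {p. \<exists>k. k \<in># p \<and> odd k}"
    and eq: "odd_plus2 p = odd_plus2 p'"
  then have odd: "\<exists>k. k \<in># p \<and> odd k" "\<exists>k. k \<in># p' \<and> odd k"
    by auto
  obtain m q where p: "p = add_mset m q" "odd m" "\<And>k. k \<in># q \<Longrightarrow> odd k \<Longrightarrow> k \<le> m"
      "odd_plus2 p = add_mset (m + 2) q"
    using odd(1) by (rule odd_plus2_split) blast
  obtain m' q' where p': "p' = add_mset m' q'" "odd m'" "\<And>k. k \<in># q' \<Longrightarrow> odd k \<Longrightarrow> k \<le> m'"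
      "odd_plus2 p' = add_mset (m' + 2) q'"
    using odd(2) by (rule odd_plus2_split) blast
  have *: "add_mset (m + 2) q = add_mset (m' + 2) q'"
    using eq p(4) p'(4) by simp
  have "m = m'"
  proof (rule ccontr)
    assume "m \<noteq> m'"
    then have "m + 2 \<in># q'" "m' + 2 \<in># q"
      using * by (auto simp: add_eq_conv_ex)
    then have "m + 2 \<le> m'" "m' + 2 \<le> m"
      using p(2,3) p'(2,3) by auto
    then show False
      by simp
  qed
  with * show "p = p'"
    by (simp add: p(1) p'(1))
qed

section \<open>Counting parts along the recursion\<close>

lemma sum_size_double_parts: "(\<Sum>p\<in>double_parts ` A. size p) = (\<Sum>p\<in>A. size p)"
proof -
  have "inj double_parts"
    unfolding double_parts_def by (rule multiset.inj_map) (simp add: inj_def)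
  then have "inj_on double_parts A"
    using inj_on_subset by blast
  then show ?thesis
    by (simp add: sum.reindex) (simp add: double_parts_def)
qed

text \<open>This is the step from odd and even index to the next odd index, for both families at once.
  The union is disjoint because \<open>odd_plus2\<close> produces an odd part exceeding 1, whereas the only odd
  parts of \<open>p \<squnion> (1,1,1)\<close> are ones when \<open>p\<close> has even parts only.\<close>

lemma sum_size_odd_step_cong:
  assumes "finite A" "finite B"
    and A_odd: "\<And>p. p \<in> A \<Longrightarrow> \<exists>k. k \<in># p \<and> odd k"
    and B_even: "\<And>p k. p \<in> B \<Longrightarrow> k \<in># p \<Longrightarrow> even k"
  shows "[(\<Sum>p\<in>odd_plus2 ` A \<union> (\<lambda>p. p + {#1, 1, 1#}) ` B. size p)
          = (\<Sum>p\<in>A. size p) + (\<Sum>p\<in>B. size p)] (mod 3)"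
proof -
  let ?g = "\<lambda>p :: nat multiset. p + {#1, 1, 1#}"
  have disjoint: "odd_plus2 ` A \<inter> ?g ` B = {}"
  proof (rule ccontr)
    assume "odd_plus2 ` A \<inter> ?g ` B \<noteq> {}"
    then obtain p r where pr: "p \<in> A" "r \<in> B" "odd_plus2 p = ?g r"
      by auto
    obtain m q where m: "odd m" "odd_plus2 p = add_mset (m + 2) q"
      using A_odd[OF pr(1)] by (rule odd_plus2_split)
    then have "m + 2 \<in># ?g r"
      using pr(3) by (metis union_single_eq_member)
    then have "m + 2 \<in># r"
      by auto
    then show False
      using B_even[OF pr(2), of "m + 2"] m(1) by simp
  qed
  have "inj_on odd_plus2 A"
    by (rule inj_on_subset[OF inj_on_odd_plus2]) (use A_odd in auto)
  then have A: "(\<Sum>p\<in>odd_plus2 ` A. size p) = (\<Sum>p\<in>A. size p)"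
    using A_odd by (simp add: sum.reindex size_odd_plus2)
  have "inj_on ?g B"
    by (auto simp: inj_on_def)
  then have B: "(\<Sum>p\<in>?g ` B. size p) = (\<Sum>p\<in>B. size p) + 3 * card B"
    by (simp add: sum.reindex sum.distrib sum_Suc)
  have "(\<Sum>p\<in>odd_plus2 ` A \<union> ?g ` B. size p)
      = (\<Sum>p\<in>A. size p) + (\<Sum>p\<in>B. size p) + 3 * card B"
    using assms(1,2) disjoint A B by (simp add: sum.union_disjoint)
  then show ?thesis
    by (simp add: cong_def)
qed

lemma SPa_even_parts:
  assumes "even n" "p \<in> SPa n" "k \<in># p"
  shows "even k"
proof (cases "n = 0")
  case True
  with assms show ?thesis by simp
next
  case False
  with \<open>even n\<close> obtain m where "n = 2 * m" "m \<ge> 1"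
    by (auto elim!: evenE)
  with assms show ?thesis
    by (auto simp: double_parts_def)
qed

lemma SPa'_even_parts:
  assumes "even n" "p \<in> SPa' n" "k \<in># p"
  shows "even k"
proof (cases "n = 0")
  case True
  with assms show ?thesis by simp
next
  case False
  with \<open>even n\<close> obtain m where "n = 2 * m" "m \<ge> 1"
    by (auto elim!: evenE)
  with assms show ?thesis
    by (auto simp: double_parts_def)
qed

lemma pspa_double: "n \<ge> 1 \<Longrightarrow> pspa (2 * n) = pspa n"
  by (simp add: pspa_def sum_size_double_parts)

lemma pspa'_double: "n \<ge> 1 \<Longrightarrow> pspa' (2 * n) = pspa' n"
  by (simp add: pspa'_def sum_size_double_parts)

lemma pspa_odd_cong:
  assumes "n \<ge> 2"
  shows "[pspa (2 * n + 1) = pspa (2 * n - 1) + pspa (2 * n - 2)] (mod 3)"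
  unfolding pspa_def SPa.simps(5)[OF assms]
proof (rule sum_size_odd_step_cong[OF finite_SPa finite_SPa])
  show "\<exists>k. k \<in># p \<and> odd k" if "p \<in> SPa (2 * n - 1)" for p
    using SPa_odd_part[OF _ that] assms by simp
  show "even k" if "p \<in> SPa (2 * n - 2)" "k \<in># p" for p k
    using SPa_even_parts[OF _ that] by simp
qed

lemma pspa'_odd_cong:
  assumes "n \<ge> 1"
  shows "[pspa' (2 * n + 1) = pspa' (2 * n - 1) + pspa' (2 * n - 2)] (mod 3)"
  unfolding pspa'_def SPa'.simps(4)[OF assms]
proof (rule sum_size_odd_step_cong[OF finite_SPa' finite_SPa'])
  show "\<exists>k. k \<in># p \<and> odd k" if "p \<in> SPa' (2 * n - 1)" for p
    using SPa'_odd_part[OF _ that] assms by simp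
  show "even k" if "p \<in> SPa' (2 * n - 2)" "k \<in># p" for p k
    using SPa'_even_parts[OF _ that] by simp
qed

section \<open>The number of parts modulo 3\<close>

text \<open>The hypothesis excludes 0, where there is one partition and it has no parts. The induction
  follows the recursion of the partitions, whose separate value at 3 is what keeps the
  exceptional index 0 out of the odd step.\<close>

lemma pspa_cong_spa: "n \<ge> 1 \<Longrightarrow> [pspa n = spa n] (mod 3)"
proof (induction n rule: SPa.induct)
  case 1
  then show ?case by simp
next
  case 2
  show ?case
    by (simp add: pspa_def del: One_nat_def)
next
  case 3
  have "spa 3 = spa 1 + spa 0"
    using spa.simps(4)[of 1] by simp
  then have "spa 3 = 1"
    by (simp only: spa.simps(1,2) add_0)
  then show ?case
    by (simp add: pspa_def)
next
  case (4 n)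
  then show ?case
    by (simp add: pspa_double)
next
  case (5 n)
  have IH: "[pspa (2 * n - 1) + pspa (2 * n - 2) = spa (2 * n - 1) + spa (2 * n - 2)] (mod 3)"
    using 5 by (intro cong_add) auto
  have "n \<ge> 1"
    using 5(1) by simp
  then show ?case
    using cong_trans[OF pspa_odd_cong[OF 5(1)] IH] by (simp only: spa.simps(4))
qed

lemma pspa'_cong_spa': "[pspa' n = spa' n] (mod 3)"
proof (induction n rule: SPa'.induct)
  case 1
  show ?case by (simp add: pspa'_def)
next
  case 2
  show ?case
    unfolding pspa'_def SPa'.simps(2) spa'.simps(2) by simp
next
  case (3 n)
  then show ?case
    by (simp add: pspa'_double)
next
  case (4 n)
  have IH: "[pspa' (2 * n - 1) + pspa' (2 * n - 2) = spa' (2 * n - 1) + spa' (2 * n - 2)] (mod 3)"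
    using 4 by (intro cong_add) auto
  show ?case
    using cong_trans[OF pspa'_odd_cong[OF 4(1)] IH] 4(1) by (simp only: spa'.simps(4))
qed

theorem theorem5p13:
  fixes n :: nat
  assumes "n \<ge> 1"
  shows "[int (pspa' n) - int (pspa n) = int (spa' n) - int (spa n)] (mod 3)"
proof (rule cong_diff)
  show "[int (pspa' n) = int (spa' n)] (mod 3)"
    using pspa'_cong_spa'[of n] by (simp flip: cong_int_iff)
  show "[int (pspa n) = int (spa n)] (mod 3)"
    using pspa_cong_spa[OF assms] by (simp flip: cong_int_iff)
qed

end
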